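(* (AMDCT VIII) Let $n,N$ be positive integers and $\rho=\left(\frac12,\dots,\frac12\right)\in\mathbb{R}^n$. For all $k,k'\in D_N^-$, $$\sum_{s\in F_N^{\mathrm{VIII},-}}\cos_{k+\rho}^-(s)\cos_{k'+\rho}^-(s)=\left(\frac{2N+1}{4}\right)^n\delta_{kk'}.$$ Consequently any function $f:F_N^{\mathrm{VIII},-}\to\mathbb{R}$ can be expanded, for all $s\in F_N^{\mathrm{VIII},-}$, as $$f(s)=\sum_{k\in D_N^-}A_k\cos^-_{k+\rho}(s)\quad\text{with}\quad A_k=\left(\frac{4}{2N+1}\right)^n\sum_{s\in F_N^{\mathrm{VIII},-}}f(s)\cos_{k+\rho}^-(s).$$
   Context: For $\lambda,x\in\mathbb{R}^n$, the antisymmetric cosine function is $\cos^-_\lambda(x)=\sum_{\sigma\in S_n}\mathrm{sgn}(\sigma)\prod_{i=1}^n\cos(\pi\lambda_{\sigma(i)}x_i)$. Let $D_N^-=\{(k_1,\dots,k_n)\in\mathbb{Z}^n : N-1\ge k_1>k_2>\dots>k_n\ge 0\}$. The grid is $F_N^{\mathrm{VIII},-}=\left\{\left(\frac{2(r_1+\frac12)}{2N+1},\dots,\frac{2(r_n+\frac12)}{2N+1}\right) : (r_1,\dots,r_n)\in D_N^-\right\}$. *)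

theory Defs
  imports Complex_Main "HOL-Library.FuncSet" "HOL-Combinatorics.Permutations"
begin

text \<open>Vectors in $n$-space are functions on the index set \<open>{1..n}\<close>, made extensional
  (value \<open>undefined\<close> outside \<open>{1..n}\<close>) so that equality of functions is
  equality of vectors.\<close>

definition cos_minus :: "nat \<Rightarrow> (nat \<Rightarrow> real) \<Rightarrow> (nat \<Rightarrow> real) \<Rightarrow> real" where
  "cos_minus n lam x =
     (\<Sum>\<sigma> | \<sigma> permutes {1..n}.
        of_int (sign \<sigma>) * (\<Prod>i=1..n. cos (pi * lam (\<sigma> i) * x i)))"

definition D_minus :: "nat \<Rightarrow> nat \<Rightarrow> (nat \<Rightarrow> int) set" where
  "D_minus n N =
     {k \<in> {1..n} \<rightarrow>\<^sub>E UNIV.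
        int N - 1 \<ge> k 1 \<and> (\<forall>i\<in>{1..<n}. k i > k (i + 1)) \<and> k n \<ge> 0}"

definition F_VIII_minus :: "nat \<Rightarrow> nat \<Rightarrow> (nat \<Rightarrow> real) set" where
  "F_VIII_minus n N =
     (\<lambda>r. \<lambda>i\<in>{1..n}. 2 * (of_int (r i) + 1/2) / (2 * real N + 1)) ` D_minus n N"

definition shift_rho :: "nat \<Rightarrow> (nat \<Rightarrow> int) \<Rightarrow> (nat \<Rightarrow> real)" where
  "shift_rho n k = (\<lambda>i\<in>{1..n}. of_int (k i) + 1/2)"

text \<open>The sums over \<open>D_minus\<close> and \<open>F_VIII_minus\<close> are genuine finite sums.\<close>

lemma D_minus_bounds:
  assumes "k \<in> D_minus n N" "i \<in> {1..n}"
  shows "0 \<le> k i" "k i \<le> int N - 1"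
proof -
  have ends: "k 1 \<le> int N - 1" "0 \<le> k n"
    and desc: "\<forall>j\<in>{1..<n}. k j > k (j + 1)"
    using assms(1) by (simp_all add: D_minus_def)
  have anti: "1 \<le> a \<longrightarrow> b \<le> n \<longrightarrow> k b \<le> k a" if "a \<le> b" for a b
    using that
  proof (induction rule: dec_induct)
    case base
    show ?case by simp
  next
    case (step m)
    show ?case
    proof (intro impI)
      assume "1 \<le> a" "Suc m \<le> n"
      then have "m \<in> {1..<n}" using step.hyps by simp
      then have "k (m + 1) < k m" using desc by blast
      then show "k (Suc m) \<le> k a"
        using step.IH \<open>1 \<le> a\<close> \<open>Suc m \<le> n\<close> by simp
    qed
  qed
  have i: "1 \<le> i" "i \<le> n" using assms(2) by simp_all
  show "0 \<le> k i" using anti[OF i(2)] i ends by simp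
  show "k i \<le> int N - 1" using anti[OF i(1)] i ends by simp
qed

lemma finite_D_minus: "finite (D_minus n N)"
proof (rule finite_subset)
  show "D_minus n N \<subseteq> {1..n} \<rightarrow>\<^sub>E {0..int N - 1}"
  proof
    fix k assume k: "k \<in> D_minus n N"
    then have "k \<in> extensional {1..n}" by (simp add: D_minus_def PiE_iff)
    moreover have "\<forall>i\<in>{1..n}. k i \<in> {0..int N - 1}"
      using D_minus_bounds[OF k] by simp
    ultimately show "k \<in> {1..n} \<rightarrow>\<^sub>E {0..int N - 1}" by (simp add: PiE_iff)
  qed
qed (simp add: finite_PiE)

lemma finite_F_VIII_minus: "finite (F_VIII_minus n N)"
  by (simp add: F_VIII_minus_def finite_D_minus)

end

theory Submission
  imports Defs
begin

text \<open>
  After substituting the grid points, \<^term>\<open>cos_minus\<close> becomes a determinant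
  $\det (C(k_i, r_j))$ in the symmetric kernel
  $C(a,b) = \cos (2\pi(a+\frac12)(b+\frac12)/(2N+1))$, and the theorem is what the Cauchy--Binet
  formula makes of the one-dimensional discrete cosine transform of type VIII.

  In one dimension, the rows $C(a,\cdot)$, for $0 \le a < N$, are orthogonal on
  $\{0,\dots,N-1\}$ with squared norm $(2N+1)/4$ (\<open>kernel_VIII_orthogonal\<close>): the
  product formula for cosines reduces this to a telescoping sum of cosines.

  In \<open>n\<close> dimensions, the determinant is alternating in \<open>r\<close>. Expanding one of the two
  determinants in a sum over strictly decreasing \<open>r\<close> thus turns that sum into a sum
  over all \<open>r\<close> in the cube $\{0,\dots,N-1\}^n$, which factorizes
  into one-dimensional sums (\<open>altprod_orthogonal\<close>). What is left is
  $\det (c\,\delta_{k_i k'_j})$, and for strictly decreasing \<open>k\<close> and \<open>k'\<close> this is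
  $c^n\delta_{kk'}$, because only the identity permutation can match them.

  The expansion of an arbitrary function is the dual orthogonality relation,
  summed over \<open>k\<close> instead of \<open>r\<close>. It is the same relation, since the kernel is symmetric.
\<close>

section \<open>The alternating product of a kernel\<close>

text \<open>This is the determinant of the matrix $C(k_i, r_j)$.\<close>

definition altprod ::
    "nat \<Rightarrow> ('a \<Rightarrow> 'b \<Rightarrow> real) \<Rightarrow> (nat \<Rightarrow> 'a) \<Rightarrow> (nat \<Rightarrow> 'b) \<Rightarrow> real" where
  "altprod n C k r =
     (\<Sum>\<sigma> | \<sigma> permutes {1..n}. of_int (sign \<sigma>) * (\<Prod>i=1..n. C (k (\<sigma> i)) (r i)))"

lemma altprod_transpose:
  "altprod n C k r =
     (\<Sum>\<sigma> | \<sigma> permutes {1..n}. of_int (sign \<sigma>) * (\<Prod>i=1..n. C (k i) (r (\<sigma> i))))"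
proof -
  have "altprod n C k r = (\<Sum>\<sigma> | \<sigma> permutes {1..n}.
      of_int (sign (inv \<sigma>)) * (\<Prod>i=1..n. C (k (inv \<sigma> i)) (r i)))"
    unfolding altprod_def by (rule sum_permutations_inverse)
  also have "\<dots> = (\<Sum>\<sigma> | \<sigma> permutes {1..n}.
      of_int (sign \<sigma>) * (\<Prod>i=1..n. C (k i) (r (\<sigma> i))))"
  proof (rule sum.cong[OF refl])
    fix \<sigma> assume "\<sigma> \<in> {\<sigma>. \<sigma> permutes {1..n}}"
    then have \<sigma>: "\<sigma> permutes {1..n}" by simp
    have "(\<Prod>i=1..n. C (k (inv \<sigma> i)) (r i))
        = (\<Prod>i=1..n. C (k (inv \<sigma> (\<sigma> i))) (r (\<sigma> i)))"
      by (rule prod.permute[OF \<sigma>, unfolded o_def])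
    then show "of_int (sign (inv \<sigma>)) * (\<Prod>i=1..n. C (k (inv \<sigma> i)) (r i))
        = of_int (sign \<sigma>) * (\<Prod>i=1..n. C (k i) (r (\<sigma> i)))"
      using \<sigma> permutes_imp_permutation[OF _ \<sigma>]
      by (simp add: permutes_inverses sign_inverse)
  qed
  finally show ?thesis .
qed

lemma altprod_swap:
  assumes "\<And>a b. C a b = C b a"
  shows "altprod n C k r = altprod n C r k"
  unfolding altprod_transpose[of n C k r] altprod_def[of n C r k] by (simp add: assms)

lemma altprod_permute:
  assumes \<tau>: "\<tau> permutes {1..n}"
  shows "altprod n C k (r \<circ> \<tau>) = of_int (sign \<tau>) * altprod n C k r"
proof -
  have perm: "permutation \<sigma>" if "\<sigma> permutes {1..n}" for \<sigma>
    using that permutes_imp_permutation by blast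
  have "of_int (sign \<tau>) * altprod n C k r = (\<Sum>\<sigma> | \<sigma> permutes {1..n}.
      of_int (sign \<tau>) * (of_int (sign (\<tau> \<circ> \<sigma>)) * (\<Prod>i=1..n. C (k i) (r ((\<tau> \<circ> \<sigma>) i)))))"
    unfolding altprod_transpose sum_distrib_left
    by (rule setum_permutations_compose_left[OF \<tau>])
  also have "\<dots> = altprod n C k (r \<circ> \<tau>)"
    unfolding altprod_transpose
  proof (rule sum.cong[OF refl])
    fix \<sigma> assume "\<sigma> \<in> {\<sigma>. \<sigma> permutes {1..n}}"
    then have "of_int (sign \<tau>) * (of_int (sign (\<tau> \<circ> \<sigma>)) :: real) = of_int (sign \<sigma>)"
      using sign_compose[OF perm[OF \<tau>] perm[of \<sigma>]] by (simp flip: mult.assoc of_int_mult)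
    then show "of_int (sign \<tau>) *
          (of_int (sign (\<tau> \<circ> \<sigma>)) * (\<Prod>i=1..n. C (k i) (r ((\<tau> \<circ> \<sigma>) i))))
        = of_int (sign \<sigma>) * (\<Prod>i=1..n. C (k i) ((r \<circ> \<tau>) (\<sigma> i)))"
      by (simp flip: mult.assoc)
  qed
  finally show ?thesis by simp
qed

text \<open>Swapping two equal entries of \<open>r\<close> changes the sign but not the tuple.\<close>

lemma altprod_eq_0:
  assumes "\<not> inj_on r {1..n}"
  shows "altprod n C k r = 0"
proof -
  obtain i j where ij: "i \<in> {1..n}" "j \<in> {1..n}" "i \<noteq> j" "r i = r j"
    using assms by (auto simp: inj_on_def)
  have "r \<circ> transpose i j = r"
    using ij by (auto simp: transpose_def)
  then have "altprod n C k r = of_int (sign (transpose i j)) * altprod n C k r"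
    using altprod_permute[of "transpose i j" n C k r] ij by (simp add: permutes_swap_id)
  then show ?thesis using ij by (simp add: sign_swap_id)
qed

section \<open>Strictly decreasing tuples\<close>

lemma D_minus_strict:
  assumes k: "k \<in> D_minus n N" and "1 \<le> i" "i < j" "j \<le> n"
  shows "k j < k i"
proof -
  have less: "k (Suc m) < k m" if "1 \<le> m" "m < n" for m
    using k that by (auto simp: D_minus_def)
  have "Suc i \<le> j" using assms by simp
  then show ?thesis using \<open>j \<le> n\<close>
  proof (induction rule: dec_induct)
    case base
    then show ?case using less[of i] assms by simp
  next
    case (step m)
    then show ?case using assms(2) less[of m] by simp
  qed
qed

text \<open>A permutation that relates two decreasing tuples is an increasing function, so it is
  the identity.\<close>

lemma D_minus_permuted:
  assumes k: "k \<in> D_minus n N" and k': "k' \<in> D_minus n N" and \<tau>: "\<tau> permutes {1..n}"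
    and eq: "\<And>i. i \<in> {1..n} \<Longrightarrow> k i = k' (\<tau> i)"
  shows "\<tau> = id" "k = k'"
proof -
  have mono: "\<tau> i < \<tau> j" if "i < j" for i j
  proof (cases "i \<in> {1..n} \<and> j \<in> {1..n}")
    case True
    then have in_range: "\<tau> i \<in> {1..n}" "\<tau> j \<in> {1..n}"
      using permutes_in_image[OF \<tau>] by blast+
    have "k' (\<tau> j) < k' (\<tau> i)"
      using D_minus_strict[OF k, of i j] eq True that by auto
    then have "\<not> \<tau> j \<le> \<tau> i"
      using D_minus_strict[OF k', of "\<tau> j" "\<tau> i"] in_range by (cases "\<tau> j = \<tau> i") auto
    then show ?thesis by simp
  next
    case False
    have "\<tau> m \<in> {1..n} \<longleftrightarrow> m \<in> {1..n}" "m \<notin> {1..n} \<Longrightarrow> \<tau> m = m" for m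
      using permutes_in_image[OF \<tau>] \<tau> by (auto simp: permutes_def)
    from this[of i] this[of j] show ?thesis using False that by force
  qed
  then have "strict_mono \<tau>" by (simp add: strict_mono_def)
  then have "i \<le> \<tau> i" for i by (rule strict_mono_imp_increasing)
  then show id: "\<tau> = id" using permutes_natset_ge[OF \<tau>] by blast
  show "k = k'"
  proof (rule PiE_ext)
    show "k \<in> {1..n} \<rightarrow>\<^sub>E UNIV" "k' \<in> {1..n} \<rightarrow>\<^sub>E UNIV"
      using k k' by (simp_all add: D_minus_def)
  qed (use eq id in simp)
qed

lemma ex_D_minus_sorting:
  assumes "n \<ge> 1" and f: "f \<in> {1..n} \<rightarrow>\<^sub>E {0..int N - 1}" and inj: "inj_on f {1..n}"
  shows "\<exists>r \<in> D_minus n N. \<exists>\<sigma>. \<sigma> permutes {1..n} \<and> f = r \<circ> \<sigma>"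
proof -
  define xs where "xs = rev (sorted_list_of_set (f ` {1..n}))"
  define r where "r = (\<lambda>i\<in>{1..n}. xs ! (i - 1))"
  have set_xs: "set xs = f ` {1..n}" by (simp add: xs_def)
  have len: "length xs = n" using inj by (simp add: xs_def card_image)
  have dist: "distinct xs" by (simp add: xs_def)
  have "sorted_wrt (<) (rev xs)" by (simp add: xs_def)
  then have sorted: "sorted_wrt (>) xs" by (simp add: sorted_wrt_rev)
  have bij: "bij_betw r {1..n} (f ` {1..n})"
  proof -
    have "bij_betw (\<lambda>i. i - 1) {1..n} {..<n}"
      by (rule bij_betw_byWitness[where f' = Suc]) auto
    then have "bij_betw ((!) xs \<circ> (\<lambda>i. i - 1)) {1..n} (f ` {1..n})"
      using bij_betw_nth[OF dist] len set_xs by (auto intro: bij_betw_trans)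
    then show ?thesis by (rule bij_betw_cong[THEN iffD1, rotated]) (simp add: r_def)
  qed
  have bounds: "0 \<le> r i \<and> r i \<le> int N - 1" if "i \<in> {1..n}" for i
  proof -
    have "r i \<in> f ` {1..n}" using bij that by (auto simp: bij_betw_def)
    then show ?thesis using f by (auto simp: PiE_iff)
  qed
  have "r \<in> D_minus n N"
    unfolding D_minus_def
  proof (intro CollectI conjI ballI)
    fix i assume i: "i \<in> {1..<n}"
    then have "xs ! (i - 1) > xs ! i"
      using sorted_wrt_nth_less[OF sorted, of "i - 1" i] len by auto
    then show "r (i + 1) < r i" using i by (simp add: r_def)
  next
    show "r \<in> {1..n} \<rightarrow>\<^sub>E UNIV" by (simp add: r_def)
  qed (use bounds \<open>n \<ge> 1\<close> in auto)
  moreover define \<sigma> where "\<sigma> = (\<lambda>i. if i \<in> {1..n} then inv_into {1..n} r (f i) else i)"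
  have "bij_betw (inv_into {1..n} r \<circ> f) {1..n} {1..n}"
    using inj by (intro bij_betw_trans[OF _ bij_betw_inv_into[OF bij]]) (simp add: bij_betw_def)
  then have "bij_betw \<sigma> {1..n} {1..n}"
    by (rule bij_betw_cong[THEN iffD1, rotated]) (simp add: \<sigma>_def)
  then have "\<sigma> permutes {1..n}" by (rule bij_imp_permutes) (auto simp: \<sigma>_def)
  moreover have "f = r \<circ> \<sigma>"
  proof
    fix i
    show "f i = (r \<circ> \<sigma>) i"
    proof (cases "i \<in> {1..n}")
      case True
      then show ?thesis using bij
        by (simp add: \<sigma>_def bij_betw_def f_inv_into_f)
    next
      case False
      then show ?thesis using f by (auto simp: \<sigma>_def r_def PiE_iff extensional_def)
    qed
  qed
  ultimately show ?thesis by blast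
qed

text \<open>This describes the tuples in the cube at which \<^const>\<open>altprod\<close> can be nonzero.\<close>

lemma bij_betw_D_minus_permutations:
  assumes "n \<ge> 1"
  shows "bij_betw (\<lambda>(r, \<sigma>). r \<circ> \<sigma>) (D_minus n N \<times> {\<sigma>. \<sigma> permutes {1..n}})
     {f \<in> {1..n} \<rightarrow>\<^sub>E {0..int N - 1}. inj_on f {1..n}}"
  unfolding bij_betw_def
proof
  show "inj_on (\<lambda>(r, \<sigma>). r \<circ> \<sigma>) (D_minus n N \<times> {\<sigma>. \<sigma> permutes {1..n}})"
  proof (rule inj_onI, clarify)
    fix r \<sigma> r' \<sigma>'
    assume r: "r \<in> D_minus n N" "r' \<in> D_minus n N"
      and \<sigma>: "\<sigma> permutes {1..n}" and \<sigma>': "\<sigma>' permutes {1..n}" and eq: "r \<circ> \<sigma> = r' \<circ> \<sigma>'"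
    define \<tau> where "\<tau> = \<sigma>' \<circ> inv \<sigma>"
    have \<tau>: "\<tau> permutes {1..n}"
      unfolding \<tau>_def by (intro permutes_compose permutes_inv \<sigma> \<sigma>')
    have "r i = r' (\<tau> i)" for i
      using fun_cong[OF eq, of "inv \<sigma> i"] by (simp add: \<tau>_def permutes_inverses[OF \<sigma>])
    then have "\<tau> = id" "r = r'" using D_minus_permuted[OF r \<tau>] by blast+
    moreover from \<open>\<tau> = id\<close> have "\<sigma>' = \<sigma>"
      unfolding \<tau>_def by (metis comp_assoc comp_id id_comp permutes_inv_o(2)[OF \<sigma>])
    ultimately show "r = r' \<and> \<sigma> = \<sigma>'" by simp
  qed
  show "(\<lambda>(r, \<sigma>). r \<circ> \<sigma>) ` (D_minus n N \<times> {\<sigma>. \<sigma> permutes {1..n}})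
      = {f \<in> {1..n} \<rightarrow>\<^sub>E {0..int N - 1}. inj_on f {1..n}}" (is "?L = ?R")
  proof
    show "?R \<subseteq> ?L"
    proof
      fix f assume "f \<in> ?R"
      then obtain r \<sigma> where "r \<in> D_minus n N" "\<sigma> permutes {1..n}" "f = r \<circ> \<sigma>"
        using ex_D_minus_sorting[OF assms] by blast
      then show "f \<in> ?L" by (intro image_eqI[of _ _ "(r, \<sigma>)"]) auto
    qed
    show "?L \<subseteq> ?R"
    proof clarify
      fix r \<sigma> assume r: "r \<in> D_minus n N" and \<sigma>: "\<sigma> permutes {1..n}"
      have "inj_on r {1..n}"
      proof (rule linorder_inj_onI)
        fix i j assume "i < j" "i \<in> {1..n}" "j \<in> {1..n}"
        then show "r i \<noteq> r j" using D_minus_strict[OF r, of i j] by simp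
      qed auto
      then have "inj_on (r \<circ> \<sigma>) {1..n}"
        using \<sigma> by (intro comp_inj_on) (simp_all add: permutes_inj_on permutes_image)
      moreover have "(r \<circ> \<sigma>) i \<in> {0..int N - 1}" if "i \<in> {1..n}" for i
        using D_minus_bounds[OF r, of "\<sigma> i"] permutes_in_image[OF \<sigma>] that by simp
      moreover have "(r \<circ> \<sigma>) i = undefined" if "i \<notin> {1..n}" for i
      proof -
        have "\<sigma> i = i" using \<sigma> that by (simp add: permutes_def)
        moreover have "r i = undefined" using r that by (auto simp: D_minus_def PiE_iff extensional_def)
        ultimately show ?thesis by simp
      qed
      ultimately show "r \<circ> \<sigma> \<in> ({1..n} \<rightarrow>\<^sub>E {0..int N - 1}) \<and> inj_on (r \<circ> \<sigma>) {1..n}"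
        by (auto simp: PiE_iff extensional_def)
    qed
  qed
qed

section \<open>Orthogonality of alternating products\<close>

text \<open>Cauchy--Binet for a kernel with orthogonal rows: expanding the first factor supplies the
  permutations that turn decreasing tuples into all injective ones, and the second factor
  vanishes at the remaining tuples.\<close>

lemma altprod_orthogonal:
  fixes C :: "int \<Rightarrow> int \<Rightarrow> real"
  assumes "n \<ge> 1"
    and orth: "\<And>a a'. a \<in> {0..int N - 1} \<Longrightarrow> a' \<in> {0..int N - 1} \<Longrightarrow>
           (\<Sum>b\<in>{0..int N - 1}. C a b * C a' b) = (if a = a' then c else 0)"
    and k: "k \<in> D_minus n N" and k': "k' \<in> D_minus n N"
  shows "(\<Sum>r\<in>D_minus n N. altprod n C k r * altprod n C k' r) = (if k = k' then c ^ n else 0)"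
proof -
  let ?P = "{\<sigma>. \<sigma> permutes {1..n}}"
  let ?T = "{1..n} \<rightarrow>\<^sub>E {0..int N - 1}"
  let ?g = "\<lambda>r. (\<Prod>i=1..n. C (k i) (r i)) * altprod n C k' r"
  have finT: "finite ?T" by (simp add: finite_PiE)
  have "altprod n C k r * altprod n C k' r = (\<Sum>\<sigma>\<in>?P. ?g (r \<circ> \<sigma>))" for r
    unfolding altprod_transpose[of n C k] sum_distrib_right
    by (rule sum.cong) (simp_all add: altprod_permute)
  then have "(\<Sum>r\<in>D_minus n N. altprod n C k r * altprod n C k' r)
      = (\<Sum>(r, \<sigma>)\<in>D_minus n N \<times> ?P. ?g (r \<circ> \<sigma>))"
    by (simp add: sum.cartesian_product)
  also have "\<dots> = (\<Sum>f\<in>{f \<in> ?T. inj_on f {1..n}}. ?g f)"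
    using sum.reindex_bij_betw[OF bij_betw_D_minus_permutations[OF \<open>n \<ge> 1\<close>, of N], of ?g]
    by (simp add: case_prod_unfold)
  also have "\<dots> = (\<Sum>f\<in>?T. ?g f)"
    by (rule sum.mono_neutral_left) (use finT altprod_eq_0 in auto)
  also have "\<dots> = (\<Sum>\<tau>\<in>?P. \<Sum>f\<in>?T. of_int (sign \<tau>) *
      (\<Prod>i=1..n. C (k i) (f i) * C (k' (\<tau> i)) (f i)))"
    unfolding altprod_def sum_distrib_left
    by (subst sum.swap) (simp add: prod.distrib mult_ac)
  also have "\<dots> = (\<Sum>\<tau>\<in>?P. of_int (sign \<tau>) *
      (\<Prod>i=1..n. \<Sum>b\<in>{0..int N - 1}. C (k i) b * C (k' (\<tau> i)) b))"
    by (subst prod_sum_PiE) (simp_all add: sum_distrib_left)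
  also have "\<dots> = (\<Sum>\<tau>\<in>?P. if \<tau> = id then if k = k' then c ^ n else 0 else 0)"
  proof (rule sum.cong[OF refl])
    fix \<tau> assume "\<tau> \<in> ?P"
    then have \<tau>: "\<tau> permutes {1..n}" by simp
    have "(\<Prod>i=1..n. \<Sum>b\<in>{0..int N - 1}. C (k i) b * C (k' (\<tau> i)) b)
        = (\<Prod>i=1..n. if k i = k' (\<tau> i) then c else 0)"
    proof (rule prod.cong[OF refl])
      fix i assume i: "i \<in> {1..n}"
      then have "\<tau> i \<in> {1..n}" using permutes_in_image[OF \<tau>] by blast
      with i show "(\<Sum>b\<in>{0..int N - 1}. C (k i) b * C (k' (\<tau> i)) b)
          = (if k i = k' (\<tau> i) then c else 0)"
        using D_minus_bounds[OF k] D_minus_bounds[OF k'] by (intro orth) auto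
    qed
    also have "of_int (sign \<tau>) * \<dots> =
        (if \<tau> = id then if k = k' then c ^ n else 0 else 0)"
    proof (cases "\<forall>i\<in>{1..n}. k i = k' (\<tau> i)")
      case True
      then show ?thesis using D_minus_permuted[OF k k' \<tau>] by simp
    next
      case False
      then have "(\<Prod>i=1..n. if k i = k' (\<tau> i) then c else 0) = 0" by auto
      then show ?thesis using False by auto
    qed
    finally show "of_int (sign \<tau>) *
        (\<Prod>i=1..n. \<Sum>b\<in>{0..int N - 1}. C (k i) b * C (k' (\<tau> i)) b)
        = (if \<tau> = id then if k = k' then c ^ n else 0 else 0)" .
  qed
  also have "\<dots> = (if k = k' then c ^ n else 0)"
    by (simp add: finite_permutations)
  finally show ?thesis .
qed

section \<open>The one-dimensional transform\<close>

definition kernel_VIII :: "nat \<Rightarrow> int \<Rightarrow> int \<Rightarrow> real" where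
  "kernel_VIII N a b = cos (pi * (of_int a + 1/2) * (2 * (of_int b + 1/2) / (2 * real N + 1)))"

lemma kernel_VIII_commute: "kernel_VIII N a b = kernel_VIII N b a"
  by (simp add: kernel_VIII_def algebra_simps)

text \<open>Multiplied by $2\sin(m\pi/(2N+1))$, which is nonzero for these \<open>m\<close>, the sum
  telescopes to $\sin(2Nm\pi/(2N+1)) = -(-1)^m\sin(m\pi/(2N+1))$.\<close>

lemma sum_cos_odd_multiples:
  fixes m :: int
  assumes "0 < m" "m < 2 * int N + 1"
  shows "(\<Sum>j<N. cos (of_int m * pi * (2 * real j + 1) / (2 * real N + 1)))
    = (if even m then - 1/2 else 1/2)"
proof -
  define t where "t = of_int m * pi / (2 * real N + 1)"
  have "(of_int m :: real) < of_int (2 * int N + 1)" using assms(2) by (simp only: of_int_less_iff)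
  then have "pi * of_int m < pi * (2 * real N + 1)" by simp
  then have "0 < t" "t < pi" using assms(1) by (simp_all add: t_def field_simps)
  then have "sin t > 0" by (rule sin_gt_zero)
  have tele: "2 * sin t * (\<Sum>j<M. cos (t * (2 * real j + 1))) = sin (2 * real M * t)" for M
  proof (induction M)
    case (Suc M)
    have "2 * sin t * cos (t * (2 * real M + 1)) = sin (2 * real (Suc M) * t) - sin (2 * real M * t)"
      using sin_add[of "t * (2 * real M + 1)" t] sin_diff[of "t * (2 * real M + 1)" t]
      by (simp add: algebra_simps)
    then show ?case using Suc by (simp add: algebra_simps)
  qed simp
  have "2 * real N * t = of_int m * pi - t"
    by (simp add: t_def field_simps)
  then have "sin (2 * real N * t) = sin (of_int m * pi - t)" by simp
  also have "\<dots> = - cos (of_int m * pi) * sin t"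
    by (simp add: sin_diff sin_int_times_real mult.commute)
  also have "cos (of_int m * pi) = (if even m then 1 else - 1)"
    by (simp add: cos_npi_int mult.commute)
  finally have "2 * sin t * (\<Sum>j<N. cos (t * (2 * real j + 1)))
      = - (if even m then 1 else - 1) * sin t"
    using tele[of N] by simp
  then have "sin t * (2 * (\<Sum>j<N. cos (t * (2 * real j + 1)))) = sin t * (if even m then - 1 else 1)"
    by (simp add: mult_ac)
  then have "2 * (\<Sum>j<N. cos (t * (2 * real j + 1))) = (if even m then - 1 else 1)"
    using \<open>sin t > 0\<close> by (simp only: mult_cancel_left) simp
  then have "(\<Sum>j<N. cos (t * (2 * real j + 1))) = (if even m then - 1/2 else 1/2)"
    by (cases "even m") simp_all
  then show ?thesis by (simp add: t_def)
qed

text \<open>The frequencies \<open>a - a'\<close> and \<open>a + a' + 1\<close> of the product of two cosines have opposite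
  parity, so for \<open>a \<noteq> a'\<close> their contributions cancel.\<close>

lemma kernel_VIII_orthogonal:
  assumes a: "a \<in> {0..int N - 1}" and a': "a' \<in> {0..int N - 1}"
  shows "(\<Sum>b\<in>{0..int N - 1}. kernel_VIII N a b * kernel_VIII N a' b)
    = (if a = a' then (2 * real N + 1) / 4 else 0)"
proof -
  define S where "S = (\<lambda>m::int. \<Sum>j<N. cos (of_int m * pi * (2 * real j + 1) / (2 * real N + 1)))"
  have S: "S m = (if even m then - 1/2 else 1/2)" if "0 < m" "m < 2 * int N + 1" for m
    unfolding S_def using that by (rule sum_cos_odd_multiples)
  have S_minus: "S (- m) = S m" for m by (simp add: S_def)
  have prod: "kernel_VIII N a (int j) * kernel_VIII N a' (int j) =
      (cos (of_int (a - a') * pi * (2 * real j + 1) / (2 * real N + 1))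
       + cos (of_int (a + a' + 1) * pi * (2 * real j + 1) / (2 * real N + 1))) / 2" for j
  proof -
    have u: "pi * (of_int x + 1/2) * (2 * (real j + 1/2) / (2 * real N + 1))
        = (of_int x + 1/2) * (pi * (2 * real j + 1) / (2 * real N + 1))" for x :: int
      by (simp add: field_simps)
    have "kernel_VIII N a (int j) * kernel_VIII N a' (int j) =
      cos ((of_int a + 1/2) * (pi * (2 * real j + 1) / (2 * real N + 1)))
      * cos ((of_int a' + 1/2) * (pi * (2 * real j + 1) / (2 * real N + 1)))"
      by (simp only: kernel_VIII_def of_int_of_nat_eq u)
    also have "\<dots> = (cos ((of_int a - of_int a') * (pi * (2 * real j + 1) / (2 * real N + 1)))
       + cos ((of_int a + of_int a' + 1) * (pi * (2 * real j + 1) / (2 * real N + 1)))) / 2"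
    proof -
      define t where "t = pi * (2 * real j + 1) / (2 * real N + 1)"
      have "(of_int a + 1/2) * t - (of_int a' + 1/2) * t = (of_int a - of_int a') * t"
        "(of_int a + 1/2) * t + (of_int a' + 1/2) * t = (of_int a + of_int a' + 1) * t"
        by (simp_all add: algebra_simps)
      then show ?thesis unfolding t_def[symmetric] cos_times_cos by presburger
    qed
    finally show ?thesis by (simp add: mult.assoc)
  qed
  have "bij_betw int {..<N} {0..int N - 1}"
    by (rule bij_betw_byWitness[where f' = nat]) auto
  then have "(\<Sum>b\<in>{0..int N - 1}. kernel_VIII N a b * kernel_VIII N a' b)
      = (\<Sum>j<N. kernel_VIII N a (int j) * kernel_VIII N a' (int j))"
    by (rule sum.reindex_bij_betw[symmetric])
  also have "\<dots> = (S (a - a') + S (a + a' + 1)) / 2"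
    unfolding prod S_def by (simp add: sum.distrib flip: sum_divide_distrib)
  also have "\<dots> = (if a = a' then (2 * real N + 1) / 4 else 0)"
  proof (cases "a = a'")
    case True
    have "S (a + a' + 1) = 1/2" using S[of "a + a' + 1"] a a' True by simp
    moreover have "S 0 = real N" by (simp add: S_def)
    ultimately show ?thesis using True by (simp add: field_simps)
  next
    case False
    have "S (a - a') = S \<bar>a - a'\<bar>" using S_minus[of "a - a'"] by (simp add: abs_if)
    also have "\<dots> = (if even \<bar>a - a'\<bar> then - 1/2 else 1/2)"
      by (rule S) (use a a' False in auto)
    finally have "S (a - a') = (if even (a - a') then - 1/2 else 1/2)" by simp
    moreover have "S (a + a' + 1) = (if even (a + a' + 1) then - 1/2 else 1/2)"
      using S[of "a + a' + 1"] a a' by simp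
    ultimately show ?thesis using False by simp
  qed
  finally show ?thesis .
qed

section \<open>The antisymmetric transform of type VIII\<close>

definition grid_point :: "nat \<Rightarrow> nat \<Rightarrow> (nat \<Rightarrow> int) \<Rightarrow> (nat \<Rightarrow> real)" where
  "grid_point n N r = (\<lambda>i\<in>{1..n}. 2 * (of_int (r i) + 1/2) / (2 * real N + 1))"

lemma bij_betw_grid_point: "bij_betw (grid_point n N) (D_minus n N) (F_VIII_minus n N)"
  unfolding bij_betw_def
proof
  show "grid_point n N ` D_minus n N = F_VIII_minus n N"
    by (simp add: F_VIII_minus_def grid_point_def)
  show "inj_on (grid_point n N) (D_minus n N)"
  proof (rule inj_onI)
    fix r r'
    assume r: "r \<in> D_minus n N" "r' \<in> D_minus n N"
      and eq: "grid_point n N r = grid_point n N r'"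
    show "r = r'"
    proof (rule PiE_ext)
      show "r \<in> {1..n} \<rightarrow>\<^sub>E UNIV" "r' \<in> {1..n} \<rightarrow>\<^sub>E UNIV"
        using r by (simp_all add: D_minus_def)
      fix i assume "i \<in> {1..n}"
      then show "r i = r' i"
        using fun_cong[OF eq, of i] by (simp add: grid_point_def field_simps)
    qed
  qed
qed

lemma cos_minus_grid_point:
  "cos_minus n (shift_rho n k) (grid_point n N r) = altprod n (kernel_VIII N) k r"
  unfolding cos_minus_def altprod_def
proof (rule sum.cong[OF refl])
  fix \<sigma> assume "\<sigma> \<in> {\<sigma>. \<sigma> permutes {1..n}}"
  then have "\<sigma> i \<in> {1..n} \<longleftrightarrow> i \<in> {1..n}" for i
    using permutes_in_image[of \<sigma>] by blast
  then have "(\<Prod>i=1..n. cos (pi * shift_rho n k (\<sigma> i) * grid_point n N r i))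
      = (\<Prod>i=1..n. kernel_VIII N (k (\<sigma> i)) (r i))"
    by (intro prod.cong[OF refl]) (simp add: shift_rho_def grid_point_def kernel_VIII_def)
  then show "of_int (sign \<sigma>) * (\<Prod>i=1..n. cos (pi * shift_rho n k (\<sigma> i) * grid_point n N r i))
      = of_int (sign \<sigma>) * (\<Prod>i=1..n. kernel_VIII N (k (\<sigma> i)) (r i))" by simp
qed

theorem mainTheorem4:
  fixes n N :: nat
  assumes "n \<ge> 1" and "N \<ge> 1"
  shows "(\<forall>k \<in> D_minus n N. \<forall>k' \<in> D_minus n N.
            (\<Sum>s \<in> F_VIII_minus n N.
               cos_minus n (shift_rho n k) s * cos_minus n (shift_rho n k') s)
            = ((2 * real N + 1) / 4) ^ n * (if k = k' then 1 else 0))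
       \<and> (\<forall>f :: (nat \<Rightarrow> real) \<Rightarrow> real. \<forall>s \<in> F_VIII_minus n N.
            f s = (\<Sum>k \<in> D_minus n N.
              ((4 / (2 * real N + 1)) ^ n *
                 (\<Sum>t \<in> F_VIII_minus n N. f t * cos_minus n (shift_rho n k) t))
              * cos_minus n (shift_rho n k) s))"
proof -
  let ?D = "D_minus n N"
  let ?A = "altprod n (kernel_VIII N)"
  define c where "c = (2 * real N + 1) / 4"
  have c: "(4 / (2 * real N + 1)) ^ n * c ^ n = 1"
    by (simp add: c_def flip: power_mult_distrib)
  have orth: "(\<Sum>r\<in>?D. ?A k r * ?A k' r) = (if k = k' then c ^ n else 0)"
    if "k \<in> ?D" "k' \<in> ?D" for k k'
    unfolding c_def by (rule altprod_orthogonal[OF \<open>n \<ge> 1\<close> kernel_VIII_orthogonal that])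
  have sum_F: "(\<Sum>s\<in>F_VIII_minus n N. h s) = (\<Sum>r\<in>?D. h (grid_point n N r))"
    for h :: "(nat \<Rightarrow> real) \<Rightarrow> real"
    by (rule sum.reindex_bij_betw[OF bij_betw_grid_point, symmetric])
  have expansion: "f (grid_point n N q) = (\<Sum>k\<in>?D.
      ((4 / (2 * real N + 1)) ^ n * (\<Sum>r\<in>?D. f (grid_point n N r) * ?A k r)) * ?A k q)"
    if q: "q \<in> ?D" for f q
  proof -
    have "(\<Sum>k\<in>?D. ((4 / (2 * real N + 1)) ^ n *
          (\<Sum>r\<in>?D. f (grid_point n N r) * ?A k r)) * ?A k q)
        = (\<Sum>k\<in>?D. \<Sum>r\<in>?D. (4 / (2 * real N + 1)) ^ n *
            f (grid_point n N r) * (?A k r * ?A k q))"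
      by (simp add: sum_distrib_left sum_distrib_right mult_ac)
    also have "\<dots> = (\<Sum>r\<in>?D. (4 / (2 * real N + 1)) ^ n *
            f (grid_point n N r) * (\<Sum>k\<in>?D. ?A k r * ?A k q))"
      by (subst sum.swap) (simp add: sum_distrib_left)
    also have "\<dots> = (\<Sum>r\<in>?D. (4 / (2 * real N + 1)) ^ n *
            f (grid_point n N r) * (\<Sum>k\<in>?D. ?A r k * ?A q k))"
      by (simp only: altprod_swap[OF kernel_VIII_commute])
    also have "\<dots> = (\<Sum>r\<in>?D. if r = q then (4 / (2 * real N + 1)) ^ n *
            f (grid_point n N r) * c ^ n else 0)"
      by (rule sum.cong) (simp_all add: orth q)
    also have "\<dots> = ((4 / (2 * real N + 1)) ^ n * c ^ n) * f (grid_point n N q)"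
      using q by (simp add: finite_D_minus)
    finally show ?thesis using c by simp
  qed
  show ?thesis
  proof (intro conjI ballI allI)
    fix k k' assume "k \<in> ?D" "k' \<in> ?D"
    then show "(\<Sum>s \<in> F_VIII_minus n N.
               cos_minus n (shift_rho n k) s * cos_minus n (shift_rho n k') s)
            = ((2 * real N + 1) / 4) ^ n * (if k = k' then 1 else 0)"
      by (simp add: sum_F cos_minus_grid_point orth c_def)
  next
    fix f :: "(nat \<Rightarrow> real) \<Rightarrow> real" and s assume "s \<in> F_VIII_minus n N"
    then obtain q where "q \<in> ?D" "s = grid_point n N q"
      using bij_betw_grid_point[of n N] by (auto simp: bij_betw_def)
    then show "f s = (\<Sum>k \<in> ?D.
              ((4 / (2 * real N + 1)) ^ n *
                 (\<Sum>t \<in> F_VIII_minus n N. f t * cos_minus n (shift_rho n k) t))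
              * cos_minus n (shift_rho n k) s)"
      using expansion[of q f] by (simp add: sum_F cos_minus_grid_point)
  qed
qed

end
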